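(* Let $\mathcal{P}=(\mathcal{E},D,c,f_c)$ be a combinatorial sum problem and $E=\{e_1,e_2,e_3\}\subseteq\mathcal{E}$. Then: (a) If $f_c(D_{+}(E))=c^\ast$, then $u'_{\mathcal{P}}(E)=\min\{f_c(D_{-}(E))-c^\ast,\ u'_{\mathcal{P}}(e_1)+u'_{\mathcal{P}}(e_2,e_3),\ u'_{\mathcal{P}}(e_2)+u'_{\mathcal{P}}(e_1,e_3),\ u'_{\mathcal{P}}(e_3)+u'_{\mathcal{P}}(e_1,e_2),\ \tfrac12(u'_{\mathcal{P}}(e_1,e_2)+u'_{\mathcal{P}}(e_1,e_3)+u'_{\mathcal{P}}(e_2,e_3))\}$. (b) If the hypothesis of (a) fails and $f_c(D_{\sim}(e_1;e_2,e_3))=f_c(D_{\sim}(e_2;e_1,e_3))=f_c(D_{\sim}(e_3;e_1,e_2))=c^\ast$, then $u'_{\mathcal{P}}(E)=\min\{3(f_c(D_{\sim}(e_2,e_3;e_1))-c^\ast),\ 3(f_c(D_{\sim}(e_1,e_3;e_2))-c^\ast),\ 3(f_c(D_{\sim}(e_1,e_2;e_3))-c^\ast),\ \tfrac32(f_c(D_{-}(E))-c^\ast)\}$. (c) If the hypotheses of (a) and (b) fail and there is $\{i_1,i_2,i_3\}=\{1,2,3\}$ with $f_c(D_{\sim}(e_{i_3};e_{i_1},e_{i_2}))=f_c(D_{\sim}(e_{i_2};e_{i_1},e_{i_3}))=c^\ast$, then $u'_{\mathcal{P}}(E)=\min\{f_c(D_{\sim}(e_{i_1};e_{i_2},e_{i_3}))-c^\ast+3(f_c(D_{\sim}(e_{i_2},e_{i_3};e_{i_1}))-c^\ast),\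 f_c(D_{\sim}(e_{i_1},e_{i_3};e_{i_2}))-c^\ast+2(f_c(D_{\sim}(e_{i_2},e_{i_3};e_{i_1}))-c^\ast),\ f_c(D_{\sim}(e_{i_1},e_{i_2};e_{i_3}))-c^\ast+2(f_c(D_{\sim}(e_{i_2},e_{i_3};e_{i_1}))-c^\ast),\ f_c(D_{\sim}(e_{i_2},e_{i_3};e_{i_1}))-c^\ast+f_c(D_{-}(E))-c^\ast,\ 2(f_c(D_{-}(E))-c^\ast)\}$. (d) If the hypotheses of (a), (b), (c) fail and there is $\{i_1,i_2,i_3\}=\{1,2,3\}$ with $f_c(D_{\sim}(e_{i_3};e_{i_1},e_{i_2}))=f_c(D_{\sim}(e_{i_1},e_{i_2};e_{i_3}))=c^\ast$, then $u'_{\mathcal{P}}(E)=\min\{2(f_c(D_{\sim}(e_{i_2},e_{i_3};e_{i_1}))-c^\ast+f_c(D_{\sim}(e_{i_1},e_{i_3};e_{i_2}))-c^\ast),\ 2(f_c(D_{-}(E))-c^\ast)\}$. (e) If the hypotheses of (a)–(d) fail and $f_c(D_{\sim}(e_1,e_2;e_3))=f_c(D_{\sim}(e_1,e_3;e_2))=f_c(D_{\sim}(e_2,e_3;e_1))=c^\ast$, then $u'_{\mathcal{P}}(E)=3(f_c(D_{-}(E))-c^\ast)$. (f) If none of the hypotheses of (a)–(e) holds, then $u'_{\mathcal{P}}(E)=\infty$.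
   Context: A combinatorial sum problem (CSP) is a tuple $\mathcal{P}=(\mathcal{E},D,c,f_c)$, where $\mathcal{E}$ is a finite ground set, $D\subseteq 2^{\mathcal{E}}\setminus\{\emptyset\}$ is the set of feasible solutions, $c:\mathcal{E}\to\mathbb{R}$ and $f_c(S)=\sum_{e\in S}c(e)$ for $S\in D$. For $M\subseteq D$, $f_c(M)=\min_{S\in M}f_c(S)$, with $f_c(\emptyset)=\infty$; $c^\ast=f_c(D)$ and an optimal solution is $S^\ast\in D$ with $f_c(S^\ast)=c^\ast$. For $A,B\subseteq\mathcal{E}$: $D_{-}(A)=\{S\in D: A\cap S=\emptyset\}$, $D_{+}(A)=\{S\in D: A\subseteq S\}$, $D_{\sim}(A;B)=\{S\in D: A\cap S=\emptyset,\ B\subseteq S\}$; set braces are omitted, e.g. $D_{\sim}(e_1;e_2,e_3)=D_{\sim}(\{e_1\};\{e_2,e_3\})$. For $E=\{e_1,\dots,e_k\}$ and $\vec\alpha\in\mathbb{R}^k$, $\mathcal{P}_{c_{\vec\alpha,E}}$ is the CSP with cost of $e_i$ changed to $c(e_i)+\alpha_i$ and all other costs unchanged; $\mathcal{P}_{c_{\alpha,e}}$ is the analogue for a single element. Single upper tolerance: $u'_{\mathcal{P}}(e)=\max\{\alpha\ge0:$ each optimal solution of $\mathcal{P}$ is optimal for $\mathcal{P}_{c_{\alpha,e}}\}$. Set upper tolerance of $F=\{f_1,\dots,f_m\}$: $u'_{\mathcal{P}}(F)=\max\{\alpha\in\mathbb{R}:$ for each optimal solution $S^\ast$ of $\mathcal{P}$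 there exists $\vec\alpha=(\alpha_1,\dots,\alpha_m)$ with all $\alpha_i\ge0$, $\alpha=\sum_i\alpha_i$, such that $S^\ast$ is optimal for $\mathcal{P}_{c_{\vec\alpha,F}}\}$; we write $u'_{\mathcal{P}}(e_1,e_2)=u'_{\mathcal{P}}(\{e_1,e_2\})$. Tolerances take the value $\infty$ when the corresponding set is unbounded.
   Formalization: The set upper tolerance is taken with one vector of increases that keeps every optimal solution optimal, rather than a vector chosen separately for each optimal solution; with the latter, the formulas in (b)–(e) can fail since the tolerance is then infinite. *)

theory Defs
  imports "HOL-Library.Extended_Real"
begin

record 'a csp =
  ground :: "'a set"
  feasible :: "'a set set"
  cost :: "'a \<Rightarrow> real"

definition is_csp :: "'a csp \<Rightarrow> bool" where
  "is_csp P \<longleftrightarrow> finite (ground P) \<and> feasible P \<subseteq> Pow (ground P) - {{}}"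

definition solution_cost :: "'a csp \<Rightarrow> 'a set \<Rightarrow> real" where
  "solution_cost P S = (\<Sum>e\<in>S. cost P e)"

definition min_cost :: "'a csp \<Rightarrow> 'a set set \<Rightarrow> ereal" where
  "min_cost P M = (if M = {} then \<infinity> else ereal (Min (solution_cost P ` M)))"

definition opt_value :: "'a csp \<Rightarrow> ereal" where
  "opt_value P = min_cost P (feasible P)"

definition optimal :: "'a csp \<Rightarrow> 'a set \<Rightarrow> bool" where
  "optimal P S \<longleftrightarrow> S \<in> feasible P \<and> ereal (solution_cost P S) = opt_value P"

definition D_minus :: "'a csp \<Rightarrow> 'a set \<Rightarrow> 'a set set" where
  "D_minus P A = {S \<in> feasible P. A \<inter> S = {}}"

definition D_plus :: "'a csp \<Rightarrow> 'a set \<Rightarrow> 'a set set" where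
  "D_plus P A = {S \<in> feasible P. A \<subseteq> S}"

definition D_sim :: "'a csp \<Rightarrow> 'a set \<Rightarrow> 'a set \<Rightarrow> 'a set set" where
  "D_sim P A B = {S \<in> feasible P. A \<inter> S = {} \<and> B \<subseteq> S}"

(* The vector of cost changes is indexed by the elements of F themselves;
   values of \<alpha> outside F are irrelevant. *)
definition raise_cost :: "'a csp \<Rightarrow> 'a set \<Rightarrow> ('a \<Rightarrow> real) \<Rightarrow> 'a csp" where
  "raise_cost P F \<alpha> = P\<lparr>cost := (\<lambda>e. if e \<in> F then cost P e + \<alpha> e else cost P e)\<rparr>"

(* A genuine maximum, not a supremum: for a bounded set without a greatest
   element the value is unspecified. *)
definition max_or_infinity :: "real set \<Rightarrow> ereal" where
  "max_or_infinity A = (if bdd_above A then ereal (GREATEST \<alpha>. \<alpha> \<in> A) else \<infinity>)"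

definition upper_tolerance :: "'a csp \<Rightarrow> 'a \<Rightarrow> ereal" where
  "upper_tolerance P e =
     max_or_infinity {\<alpha>. \<alpha> \<ge> 0 \<and>
       (\<forall>S. optimal P S \<longrightarrow> optimal (raise_cost P {e} (\<lambda>_. \<alpha>)) S)}"

(* One and the same vector of increases has to preserve every optimal solution.
   If the vector were allowed to depend on the optimal solution S, then any S
   missing some element of F would impose no bound at all: the whole increase
   could be put on that element. The tolerance would then be infinite as soon
   as no optimal solution contains F. *)
definition set_upper_tolerance :: "'a csp \<Rightarrow> 'a set \<Rightarrow> ereal" where
  "set_upper_tolerance P F =
     max_or_infinity {\<alpha>. \<exists>v :: 'a \<Rightarrow> real. (\<forall>f\<in>F. v f \<ge> 0) \<and> \<alpha> = (\<Sum>f\<in>F. v f) \<and>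
       (\<forall>S. optimal P S \<longrightarrow> optimal (raise_cost P F v) S)}"

end

theory Submission
  imports Defs
begin

text \<open>
Only the trace \<open>S \<inter> F\<close> of a solution matters when costs on \<open>F\<close> are raised. Let \<open>gap P F T\<close> be
the excess over the optimum of the cheapest solution with trace \<open>T\<close>. Increases \<open>v \<ge> 0\<close> preserve all
optimal solutions iff \<open>v(T) - v(U) \<le> gap P F U\<close> for all \<open>T, U \<subseteq> F\<close> with \<open>gap P F T = 0\<close>, so the
tolerance is the optimum of a linear program in \<open>v\<close>. For three elements the set of traces with gap
zero determines which of these constraints bind. If \<open>F\<close> itself has gap zero, bounding all pairs
from above turns into lower bounds on single entries once the total is fixed, which leaves a box
intersected with a hyperplane. In the cases (b)--(e) equalities between the traces leave at most
two free increases, and the extremal point is explicit. In case (f) some element of \<open>F\<close> lies in no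
optimal trace and can be raised without bound.
\<close>

text \<open>Tolerances are genuine maxima, so an upper bound on \<open>A\<close> is not enough:
  identifying \<open>A\<close> with the whole closed interval from 0 to \<open>m\<close> guarantees
  a greatest element, and \<open>m = \<infinity>\<close> gives an unbounded ray.\<close>

lemma max_or_infinity_eqI:
  assumes "\<And>\<alpha>. \<alpha> \<in> A \<longleftrightarrow> 0 \<le> \<alpha> \<and> ereal \<alpha> \<le> m" and "0 \<le> m"
  shows "max_or_infinity A = m"
proof (cases m)
  case (real r)
  have A: "A = {0..r}" by (rule set_eqI) (simp add: assms(1) real)
  have "0 \<le> r" using assms(2) real by simp
  have "(GREATEST \<alpha>. \<alpha> \<in> A) = r"
    using \<open>0 \<le> r\<close> unfolding A by (intro Greatest_equality) auto
  then show ?thesis using real A by (simp add: max_or_infinity_def)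
next
  case PInf
  have "A = {0..}" by (rule set_eqI) (simp add: assms(1) PInf)
  moreover have "\<not> bdd_above {0 :: real ..}"
  proof
    assume "bdd_above {0 :: real ..}"
    then obtain M where "\<forall>x\<in>{0 :: real ..}. x \<le> M" unfolding bdd_above_def by blast
    from bspec[OF this, of "max 0 M + 1"] show False by simp
  qed
  ultimately show ?thesis using PInf by (simp add: max_or_infinity_def)
qed (use assms(2) in auto)

section \<open>Costs, minima and optimal solutions\<close>

lemma is_csp_finite_feasible: "is_csp P \<Longrightarrow> finite (feasible P)"
  by (auto simp: is_csp_def intro: finite_subset[of _ "Pow (ground P)"])

lemma is_csp_finite_solution: "is_csp P \<Longrightarrow> S \<in> feasible P \<Longrightarrow> finite S"
  by (auto simp: is_csp_def intro: finite_subset[of _ "ground P"])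

lemma is_csp_raise_cost: "is_csp P \<Longrightarrow> is_csp (raise_cost P F v)"
  by (simp add: is_csp_def raise_cost_def)

lemma feasible_raise_cost [simp]: "feasible (raise_cost P F v) = feasible P"
  by (simp add: raise_cost_def)

lemma solution_cost_raise_cost:
  assumes "finite S"
  shows "solution_cost (raise_cost P F v) S = solution_cost P S + sum v (S \<inter> F)"
proof -
  have "solution_cost (raise_cost P F v) S = (\<Sum>e\<in>S. cost P e + (if e \<in> F then v e else 0))"
    unfolding solution_cost_def raise_cost_def by (intro sum.cong) auto
  then show ?thesis
    using assms by (simp add: sum.distrib solution_cost_def sum.inter_restrict)
qed

lemma le_min_cost_iff:
  assumes "finite M"
  shows "ereal c \<le> min_cost P M \<longleftrightarrow> (\<forall>S\<in>M. c \<le> solution_cost P S)"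
  using assms by (auto simp: min_cost_def)

lemma min_cost_eq_iff:
  assumes "finite M"
  shows "min_cost P M = ereal c \<longleftrightarrow>
    (\<exists>S\<in>M. solution_cost P S = c) \<and> (\<forall>S\<in>M. c \<le> solution_cost P S)"
  using assms by (auto simp: min_cost_def Min_eq_iff)

lemma min_cost_Un:
  assumes "finite M" "finite N"
  shows "min_cost P (M \<union> N) = min (min_cost P M) (min_cost P N)"
  using assms by (auto simp: min_cost_def image_Un Min_Un)

lemma optimal_iff:
  assumes "is_csp P"
  shows "optimal P S \<longleftrightarrow>
    S \<in> feasible P \<and> (\<forall>U\<in>feasible P. solution_cost P S \<le> solution_cost P U)"
  using is_csp_finite_feasible[OF assms] 
  by (auto simp: optimal_def opt_value_def eq_commute[of "ereal _"] min_cost_eq_iff)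

lemma ex_optimal:
  assumes "is_csp P" "feasible P \<noteq> {}"
  shows "\<exists>S. optimal P S"
proof -
  have "opt_value P = ereal (Min (solution_cost P ` feasible P))"
    using assms(2) by (simp add: opt_value_def min_cost_def)
  moreover have "Min (solution_cost P ` feasible P) \<in> solution_cost P ` feasible P"
    using is_csp_finite_feasible[OF assms(1)] assms(2) by simp
  ultimately show ?thesis by (auto simp: optimal_def)
qed

text \<open>Raising costs keeps the feasible set and adds to each solution an amount that depends
  only on its trace, so optimality becomes a family of pairwise comparisons.\<close>

lemma raise_cost_preserves_optimal_iff:
  assumes "is_csp P"
  shows "(\<forall>S. optimal P S \<longrightarrow> optimal (raise_cost P F v) S) \<longleftrightarrow>
    (\<forall>S U. optimal P S \<longrightarrow> U \<in> feasible P \<longrightarrow>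
      solution_cost P S + sum v (S \<inter> F) \<le> solution_cost P U + sum v (U \<inter> F))"
proof -
  note fin = is_csp_finite_solution[OF assms]
  show ?thesis
    by (simp add: optimal_iff[OF assms] optimal_iff[OF is_csp_raise_cost[OF assms]])
       (auto simp: solution_cost_raise_cost fin)
qed

text \<open>A vector on one element is a number, so single tolerances come under the same linear
  program as set tolerances.\<close>

lemma upper_tolerance_eq_set_upper_tolerance:
  "upper_tolerance P e = set_upper_tolerance P {e}"
proof -
  have *: "raise_cost P {e} v = raise_cost P {e} (\<lambda>_. v e)" for v
    by (rule csp.equality) (auto simp: raise_cost_def)
  have "0 \<le> \<alpha> \<and> (\<forall>S. optimal P S \<longrightarrow> optimal (raise_cost P {e} (\<lambda>_. \<alpha>)) S) \<longleftrightarrow>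
    (\<exists>v. (\<forall>f\<in>{e}. 0 \<le> v f) \<and> \<alpha> = sum v {e} \<and>
      (\<forall>S. optimal P S \<longrightarrow> optimal (raise_cost P {e} v) S))" for \<alpha>
    by (intro iffI, rule exI[of _ "\<lambda>_. \<alpha>"], simp, clarsimp simp del: feasible_raise_cost)
       (subst *[symmetric], blast)
  then show ?thesis
    by (simp only: upper_tolerance_def set_upper_tolerance_def)
qed

section \<open>Gaps of traces and their link to the tolerance\<close>

definition gap :: "'a csp \<Rightarrow> 'a set \<Rightarrow> 'a set \<Rightarrow> ereal" where
  "gap P F T = min_cost P (D_sim P (F - T) T) - opt_value P"

lemma finite_D_sim: "is_csp P \<Longrightarrow> finite (D_sim P A B)"
  using is_csp_finite_feasible[of P] by (simp add: D_sim_def)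

lemma D_sim_trace_iff:
  "T \<subseteq> F \<Longrightarrow> S \<in> D_sim P (F - T) T \<longleftrightarrow> S \<in> feasible P \<and> S \<inter> F = T"
  by (auto simp: D_sim_def)

text \<open>The finite optimal value can be moved across the inequality, which replaces the
  extended-real minimum by real comparisons with one fixed optimal solution. They are vacuous when
  no solution has trace \<open>T\<close>.\<close>

lemma le_gap_iff:
  assumes "is_csp P" "optimal P S" "T \<subseteq> F"
  shows "ereal c \<le> gap P F T \<longleftrightarrow>
    (\<forall>U\<in>feasible P. U \<inter> F = T \<longrightarrow> solution_cost P S + c \<le> solution_cost P U)"
proof -
  have "opt_value P = ereal (solution_cost P S)"
    using assms(2) by (simp add: optimal_def)
  then have "ereal c \<le> gap P F T \<longleftrightarrow>
      ereal (solution_cost P S + c) \<le> min_cost P (D_sim P (F - T) T)"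
    unfolding gap_def by (cases "min_cost P (D_sim P (F - T) T)") auto
  then show ?thesis
    unfolding le_min_cost_iff[OF finite_D_sim[OF assms(1)]]
    using D_sim_trace_iff[OF assms(3), of _ P] by auto
qed

lemma gap_empty_feasible: "feasible P = {} \<Longrightarrow> gap P F T = \<infinity>"
  by (simp add: gap_def D_sim_def min_cost_def opt_value_def)

lemma gap_nonneg:
  assumes "is_csp P" "T \<subseteq> F"
  shows "0 \<le> gap P F T"
proof (cases "feasible P = {}")
  case False
  then obtain S where S: "optimal P S" using ex_optimal assms(1) by blast
  then have "ereal 0 \<le> gap P F T"
    unfolding le_gap_iff[OF assms(1) S assms(2)] using S by (simp add: optimal_iff[OF assms(1)])
  then show ?thesis by (simp add: zero_ereal_def)
qed (simp add: gap_empty_feasible)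

lemma gap_eq_0_iff:
  assumes "is_csp P" "T \<subseteq> F"
  shows "gap P F T = 0 \<longleftrightarrow> (\<exists>S. optimal P S \<and> S \<inter> F = T)"
proof (cases "feasible P = {}")
  case False
  then obtain S where S: "optimal P S" using ex_optimal assms(1) by blast
  then have "opt_value P = ereal (solution_cost P S)" by (simp add: optimal_def)
  then have "gap P F T = 0 \<longleftrightarrow> min_cost P (D_sim P (F - T) T) = ereal (solution_cost P S)"
    unfolding gap_def by (cases "min_cost P (D_sim P (F - T) T)") (auto simp: zero_ereal_def)
  then show ?thesis
    unfolding min_cost_eq_iff[OF finite_D_sim[OF assms(1)]]
    using D_sim_trace_iff[OF assms(2), of _ P] S
    by (auto simp: optimal_iff[OF assms(1)] Bex_def) (metis order_antisym order_refl)+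
qed (simp add: gap_empty_feasible optimal_def)

text \<open>Feasibility makes the optimal value finite. Without it both sides may be
  \<open>\<infinity>\<close>, where the equation holds but the difference is
  \<open>\<infinity>\<close> instead of 0.\<close>

lemma min_cost_eq_opt_value_iff:
  assumes "is_csp P" "feasible P \<noteq> {}"
  shows "min_cost P M = opt_value P \<longleftrightarrow> min_cost P M - opt_value P = 0"
proof -
  obtain S where "optimal P S" using ex_optimal assms by blast
  then have "opt_value P = ereal (solution_cost P S)" by (simp add: optimal_def)
  then show ?thesis by (cases "min_cost P M") (auto simp: zero_ereal_def)
qed

text \<open>Solutions with trace \<open>T\<close> on \<open>F\<close> split according to whether
  they contain \<open>a\<close>. This expresses gaps over one or two elements by gaps over the
  triple.\<close>

lemma gap_insert:
  assumes "is_csp P" "a \<notin> F" "T \<subseteq> F"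
  shows "gap P F T = min (gap P (insert a F) T) (gap P (insert a F) (insert a T))"
proof -
  have "D_sim P (F - T) T =
      D_sim P (insert a F - T) T \<union> D_sim P (insert a F - insert a T) (insert a T)"
    using assms by (auto simp: D_sim_def)
  then have "min_cost P (D_sim P (F - T) T) =
      min (min_cost P (D_sim P (insert a F - T) T))
          (min_cost P (D_sim P (insert a F - insert a T) (insert a T)))"
    by (simp add: min_cost_Un finite_D_sim[OF assms(1)])
  moreover have "min x y - z = min (x - z) (y - z)" for x y z :: ereal
    using ereal_minus_mono[of x y z z] ereal_minus_mono[of y x z z] by (auto simp: min_def)
  ultimately show ?thesis by (simp add: gap_def)
qed

text \<open>The number \<open>h\<close> is the increase of the optimal value.\<close>

lemma raise_cost_preserves_optimalI:
  assumes "is_csp P"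
    and "\<And>T. T \<subseteq> F \<Longrightarrow> gap P F T = 0 \<Longrightarrow> sum v T \<le> h"
    and "\<And>U. U \<subseteq> F \<Longrightarrow> ereal (h - sum v U) \<le> gap P F U"
    and S: "optimal P S"
  shows "optimal (raise_cost P F v) S"
proof -
  have "solution_cost P S + sum v (S \<inter> F) \<le> solution_cost P U + sum v (U \<inter> F)"
    if S: "optimal P S" and U: "U \<in> feasible P" for S U
  proof -
    have "sum v (S \<inter> F) \<le> h"
      using assms(1,2) S by (auto simp: gap_eq_0_iff)
    moreover have "solution_cost P S + (h - sum v (U \<inter> F)) \<le> solution_cost P U"
      using assms(3)[of "U \<inter> F"] U by (simp add: le_gap_iff[OF assms(1) S])
    ultimately show ?thesis by simp
  qed
  then show ?thesis using S raise_cost_preserves_optimal_iff[OF assms(1)] by blast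
qed

lemma raise_cost_preserves_optimalD:
  assumes "is_csp P" "T \<subseteq> F" "U \<subseteq> F" "gap P F T = 0"
    and pres: "\<forall>S. optimal P S \<longrightarrow> optimal (raise_cost P F v) S"
  shows "ereal (sum v T - sum v U) \<le> gap P F U"
proof -
  obtain S where S: "optimal P S" "S \<inter> F = T" using assms by (auto simp: gap_eq_0_iff)
  show ?thesis
    unfolding le_gap_iff[OF assms(1) S(1) assms(3)]
    using pres S unfolding raise_cost_preserves_optimal_iff[OF assms(1)] by fastforce
qed

text \<open>The common frame for all cases. \<open>upper\<close> bounds the objective by the
  pairwise constraints; \<open>lower\<close> asks for a vector of every total \<open>r\<close> up to
  \<open>m\<close>, which also covers infinite \<open>m\<close>. The threshold \<open>h\<close>
  decouples the pairs \<open>T\<close>, \<open>U\<close> into two separate families of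
  conditions.\<close>

lemma set_upper_tolerance_eqI:
  assumes "is_csp P" "0 \<le> m"
    and upper: "\<And>v. (\<And>f. f \<in> F \<Longrightarrow> 0 \<le> v f) \<Longrightarrow>
      (\<And>T U. T \<subseteq> F \<Longrightarrow> U \<subseteq> F \<Longrightarrow> gap P F T = 0 \<Longrightarrow>
        ereal (sum v T - sum v U) \<le> gap P F U) \<Longrightarrow> ereal (sum v F) \<le> m"
    and lower: "\<And>r. 0 \<le> r \<Longrightarrow> ereal r \<le> m \<Longrightarrow>
      \<exists>v h. (\<forall>f\<in>F. 0 \<le> v f) \<and> sum v F = r \<and> (\<forall>T\<subseteq>F. gap P F T = 0 \<longrightarrow> sum v T \<le> h) \<and>
        (\<forall>U\<subseteq>F. ereal (h - sum v U) \<le> gap P F U)"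
  shows "set_upper_tolerance P F = m"
  unfolding set_upper_tolerance_def
proof (rule max_or_infinity_eqI[OF _ assms(2)], unfold mem_Collect_eq, intro iffI, goal_cases)
  case (1 \<alpha>)
  then obtain v where v: "\<forall>f\<in>F. 0 \<le> v f" "\<alpha> = sum v F"
    and pres: "\<forall>S. optimal P S \<longrightarrow> optimal (raise_cost P F v) S"
    by blast
  then show ?case
    using upper[of v] raise_cost_preserves_optimalD[OF assms(1) _ _ _ pres]
    by (auto intro: sum_nonneg)
next
  case (2 \<alpha>)
  then obtain v h where "\<forall>f\<in>F. 0 \<le> v f" "sum v F = \<alpha>"
    and *: "\<forall>T\<subseteq>F. gap P F T = 0 \<longrightarrow> sum v T \<le> h" "\<forall>U\<subseteq>F. ereal (h - sum v U) \<le> gap P F U"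
    using lower by blast
  moreover have "\<forall>S. optimal P S \<longrightarrow> optimal (raise_cost P F v) S"
    using raise_cost_preserves_optimalI[OF assms(1), of F v h] * by blast
  ultimately show ?case by blast
qed

text \<open>Put the whole increase on \<open>e\<close>: optimal solutions keep their cost and all
  others can only become dearer, so \<open>h = 0\<close> works for every total.\<close>

lemma set_upper_tolerance_eq_infinity:
  assumes "is_csp P" "finite F" "e \<in> F"
    and zero: "\<And>T. T \<subseteq> F \<Longrightarrow> gap P F T = 0 \<Longrightarrow> e \<notin> T"
  shows "set_upper_tolerance P F = \<infinity>"
proof (rule set_upper_tolerance_eqI[OF assms(1)], goal_cases)
  case (3 r)
  define v where "v = (\<lambda>f. if f = e then r else 0)"
  have "sum v T = (if e \<in> T then r else 0)" if "T \<subseteq> F" for T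
    using finite_subset[OF that assms(2)] by (simp add: v_def)
  then show ?case
    using 3 zero assms(3) gap_nonneg[OF assms(1)]
    by (intro exI[of _ v] exI[of _ 0]) (auto simp: v_def zero_ereal_def[symmetric] intro: order_trans[of _ 0])
qed auto

lemma set_upper_tolerance_single:
  assumes "is_csp P" "gap P {a} {a} = 0"
  shows "set_upper_tolerance P {a} = gap P {a} {}"
proof (rule set_upper_tolerance_eqI[OF assms(1)], goal_cases)
  case (2 v)
  then show ?case using 2(2)[of "{a}" "{}"] assms(2) by simp
next
  case (3 r)
  then show ?case
    using assms(2) by (intro exI[of _ "\<lambda>_. r"] exI[of _ r]) (auto simp: subset_singleton_iff)
qed (use gap_nonneg assms in auto)

section \<open>Tools for two and three elements, and the tolerance of a pair\<close>

lemma all_subset_pair: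
  "(\<forall>T\<subseteq>{a, b}. Q T) \<longleftrightarrow> Q {} \<and> Q {a} \<and> Q {b} \<and> Q {a, b}"
proof -
  have "(\<forall>T\<subseteq>{a, b}. Q T) \<longleftrightarrow> (\<forall>T\<in>Pow {a, b}. Q T)" by blast
  then show ?thesis by (simp add: Pow_insert) blast
qed

lemma all_subset_triple:
  "(\<forall>T\<subseteq>{a, b, c}. Q T) \<longleftrightarrow>
    Q {} \<and> Q {a} \<and> Q {b} \<and> Q {c} \<and> Q {a, b} \<and> Q {a, c} \<and> Q {b, c} \<and> Q {a, b, c}"
proof -
  have "(\<forall>T\<subseteq>{a, b, c}. Q T) \<longleftrightarrow> (\<forall>T\<in>Pow {a, b, c}. Q T)" by blast
  then show ?thesis by (simp add: Pow_insert) blast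
qed


lemma ereal_le_times_iff:
  "0 < k \<Longrightarrow> ereal r \<le> ereal k * x \<longleftrightarrow> ereal (r / k) \<le> x"
  "ereal r \<le> numeral w * x \<longleftrightarrow> ereal (r / numeral w) \<le> x"
  by (cases x; simp add: field_simps numeral_eq_ereal)+

lemma ereal_le_trans: "ereal s \<le> x \<Longrightarrow> r \<le> s \<Longrightarrow> ereal r \<le> x"
  by (rule order_trans[of _ "ereal s"]) simp_all

lemma ereal_le_nonneg: "r \<le> 0 \<Longrightarrow> 0 \<le> x \<Longrightarrow> ereal r \<le> x"
  by (rule order_trans[of _ 0]) simp_all

lemma ereal_add_le_add: "ereal r \<le> x \<Longrightarrow> ereal s \<le> y \<Longrightarrow> t = r + s \<Longrightarrow> ereal t \<le> x + y"
  using add_mono[of "ereal r" x "ereal s" y] by simp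

text \<open>Reduces the \<open>lower\<close> obligation for a triple to four numbers, the entries
  \<open>x\<close>, \<open>y\<close>, \<open>z\<close> and the threshold \<open>h\<close>, with the
  conditions listed for all eight traces.\<close>

lemma triple_witness:
  fixes g :: "'a set \<Rightarrow> ereal"
  assumes "a \<noteq> b" "a \<noteq> c" "b \<noteq> c" "0 \<le> x" "0 \<le> y" "0 \<le> z" "x + y + z = r"
    and "g {} = 0 \<Longrightarrow> 0 \<le> h" "g {a} = 0 \<Longrightarrow> x \<le> h" "g {b} = 0 \<Longrightarrow> y \<le> h" "g {c} = 0 \<Longrightarrow> z \<le> h"
      "g {a, b} = 0 \<Longrightarrow> x + y \<le> h" "g {a, c} = 0 \<Longrightarrow> x + z \<le> h" "g {b, c} = 0 \<Longrightarrow> y + z \<le> h"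
      "g {a, b, c} = 0 \<Longrightarrow> x + y + z \<le> h"
    and "ereal h \<le> g {}" "ereal (h - x) \<le> g {a}" "ereal (h - y) \<le> g {b}" "ereal (h - z) \<le> g {c}"
      "ereal (h - (x + y)) \<le> g {a, b}" "ereal (h - (x + z)) \<le> g {a, c}" "ereal (h - (y + z)) \<le> g {b, c}"
      "ereal (h - (x + y + z)) \<le> g {a, b, c}"
  shows "\<exists>v h. (\<forall>f\<in>{a, b, c}. 0 \<le> v f) \<and> sum v {a, b, c} = r \<and>
    (\<forall>T\<subseteq>{a, b, c}. g T = 0 \<longrightarrow> sum v T \<le> h) \<and>
    (\<forall>U\<subseteq>{a, b, c}. ereal (h - sum v U) \<le> g U)"
  unfolding all_subset_triple
  by (rule exI[of _ "\<lambda>e. if e = a then x else if e = b then y else z"], rule exI[of _ h])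
     (use assms in \<open>simp add: add.assoc\<close>)

text \<open>With the full trace optimal, switching to a trace \<open>U\<close> saves the increase
  outside \<open>U\<close>. Hence \<open>g {b}\<close> bounds the entry of \<open>a\<close>,
  \<open>g {a}\<close> that of \<open>b\<close>, and \<open>g {}\<close> their sum.\<close>

lemma set_upper_tolerance_pair:
  assumes "is_csp P" "a \<noteq> b" "gap P {a, b} {a, b} = 0"
  shows "set_upper_tolerance P {a, b} = min (gap P {a, b} {}) (gap P {a, b} {a} + gap P {a, b} {b})"
proof -
  define g where "g = gap P {a, b}"
  have nonneg: "0 \<le> g {}" "0 \<le> g {a}" "0 \<le> g {b}"
    using gap_nonneg[OF assms(1)] by (simp_all add: g_def)
  show ?thesis
  proof (rule set_upper_tolerance_eqI[OF assms(1)], unfold g_def[symmetric], goal_cases)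
    case 1
    then show ?case using nonneg by simp
  next
    case (2 v)
    have ab: "ereal (v a + v b - sum v U) \<le> g U" if "U \<subseteq> {a, b}" for U
      using 2(2)[OF subset_refl that] assms(2,3) by (simp add: g_def)
    have "ereal (v a + v b) \<le> g {}" "ereal (v b) \<le> g {a}" "ereal (v a) \<le> g {b}"
      using ab[of "{}"] ab[of "{a}"] ab[of "{b}"] by simp_all
    then show ?case
      using assms(2) add_mono[of "ereal (v b)" "g {a}" "ereal (v a)" "g {b}"] by (simp add: add.commute)
  next
    case (3 r)
    \<comment> \<open>Give \<open>b\<close> as much as \<open>g {a}\<close> allows. The cap at
      \<open>r\<close> keeps \<open>y\<close> real when this gap is infinite.\<close>
    define y where "y = real_of_ereal (min (g {a}) (ereal r))"
    have y: "ereal y = min (g {a}) (ereal r)"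
      using nonneg by (cases "g {a}") (auto simp: y_def min_def)
    have r: "0 \<le> r" "ereal r \<le> g {}" "ereal r \<le> g {a} + g {b}" using 3 by auto
    have "0 \<le> y" "y \<le> r" "ereal y \<le> g {a}" "ereal (r - y) \<le> g {b}"
      using r nonneg y by (cases "g {a}"; cases "g {b}"; auto simp: min_def split: if_splits)+
    moreover have "g {a, b} = 0" using assms(3) by (simp add: g_def)
    ultimately show ?case
      unfolding all_subset_pair
      by (intro exI[of _ "\<lambda>e. if e = a then r - y else y"] exI[of _ r])
         (use r nonneg assms(2) in simp)
  qed
qed

section \<open>Triples whose full trace is not optimal\<close>

lemma set_upper_tolerance_all_pairs:
  assumes "is_csp P" and neq: "a \<noteq> b" "a \<noteq> c" "b \<noteq> c"
    and g: "g = gap P {a, b, c}"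
    and zero: "g {a, b, c} \<noteq> 0" "g {b, c} = 0" "g {a, c} = 0" "g {a, b} = 0"
  shows "set_upper_tolerance P {a, b, c} =
    Min {3 * g {a}, 3 * g {b}, 3 * g {c}, ereal (3/2) * g {}}"
proof -
  have nonneg: "0 \<le> g T" if "T \<subseteq> {a, b, c}" for T
    using gap_nonneg[OF assms(1) that] by (simp add: g)
  show ?thesis
  proof (rule set_upper_tolerance_eqI[OF assms(1)], unfold g[symmetric], goal_cases)
    case 1
    then show ?case using nonneg by simp
  next
    case (2 v)
    note le = 2(2)
    \<comment> \<open>Two optimal pair traces share one element, so comparing them in both
      directions equates the increases of the other two.\<close>
    have eq: "v b = v a" "v c = v a"
      using le[of "{b, c}" "{a, c}"] le[of "{a, c}" "{b, c}"]
        le[of "{b, c}" "{a, b}"] le[of "{a, b}" "{b, c}"] zero neq by auto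
    have "ereal (2 * v a) \<le> g {}" "ereal (v a) \<le> g {a}" "ereal (v a) \<le> g {b}" "ereal (v a) \<le> g {c}"
      using le[of "{a, b}" "{}"] le[of "{a, b}" "{a}"] le[of "{a, b}" "{b}"] le[of "{a, c}" "{c}"]
        zero neq eq by simp_all
    then show ?case using neq eq by (simp add: ereal_le_times_iff)
  next
    case (3 r)
    have "ereal (r * 2 / 3) \<le> g {}" "ereal (r / 3) \<le> g {a}" "ereal (r / 3) \<le> g {b}" "ereal (r / 3) \<le> g {c}"
      using 3 by (simp_all add: ereal_le_times_iff)
    \<comment> \<open>The optimal traces rise by \<open>h = r * 2 / 3\<close> while the full trace
      rises by \<open>r\<close>, so its constraint has a nonpositive left side.\<close>
    moreover have "ereal (- (r / 3)) \<le> g {a, b, c}"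
      using 3 nonneg[of "{a, b, c}"] by (cases "g {a, b, c}") auto
    ultimately show ?case
      by (intro triple_witness[where x = "r/3" and y = "r/3" and z = "r/3" and h = "r * 2 / 3"])
         (use 3(1) neq zero in simp_all)
  qed
qed


text \<open>The two optimal pairs force equal entries on \<open>b\<close> and \<open>c\<close>. With
  \<open>p\<close> on \<open>a\<close> and \<open>q\<close> on each of the others, the terms of the
  minimum come from writing \<open>p + 2q\<close> as \<open>(p - q) + 3q\<close>, as
  \<open>p + 2q\<close> in two ways, as \<open>q + (p + q)\<close>, and bounding it by
  \<open>2(p + q)\<close>.\<close>

lemma set_upper_tolerance_two_pairs:
  assumes "is_csp P" and neq: "a \<noteq> b" "a \<noteq> c" "b \<noteq> c"
    and g: "g = gap P {a, b, c}"
    and zero: "g {a, b, c} \<noteq> 0" "g {b, c} \<noteq> 0" "g {a, c} = 0" "g {a, b} = 0"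
  shows "set_upper_tolerance P {a, b, c} =
    Min {g {b, c} + 3 * g {a}, g {b} + 2 * g {a}, g {c} + 2 * g {a}, g {a} + g {}, 2 * g {}}"
proof -
  have nonneg: "0 \<le> g T" if "T \<subseteq> {a, b, c}" for T
    using gap_nonneg[OF assms(1) that] by (simp add: g)
  show ?thesis
  proof (rule set_upper_tolerance_eqI[OF assms(1)], unfold g[symmetric], goal_cases)
    case 1
    then show ?case using nonneg by simp
  next
    case (2 v)
    note le = 2(2)
    have eq: "v c = v b"
      using le[of "{a, c}" "{a, b}"] le[of "{a, b}" "{a, c}"] zero neq by auto
    have *: "ereal (v a + v b) \<le> g {}" "ereal (v b) \<le> g {a}" "ereal (v a) \<le> g {b}"
      "ereal (v a) \<le> g {c}" "ereal (v a - v b) \<le> g {b, c}"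
      using le[of "{a, b}" "{}"] le[of "{a, b}" "{a}"] le[of "{a, b}" "{b}"] le[of "{a, c}" "{c}"]
        le[of "{a, b}" "{b, c}"] zero neq eq by simp_all
    have "ereal (2 * v b) \<le> 2 * g {a}" "ereal (3 * v b) \<le> 3 * g {a}"
      using * by (simp_all add: ereal_le_times_iff)
    then have "ereal (v a + 2 * v b) \<le> g {b, c} + 3 * g {a}" "ereal (v a + 2 * v b) \<le> g {b} + 2 * g {a}"
      "ereal (v a + 2 * v b) \<le> g {c} + 2 * g {a}" "ereal (v a + 2 * v b) \<le> g {a} + g {}"
      using * by (auto elim!: ereal_add_le_add)
    moreover have "ereal (v a + 2 * v b) \<le> 2 * g {}"
      unfolding ereal_le_times_iff using 2(1)[of a] by (intro ereal_le_trans[OF *(1)]) simp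
    ultimately show ?case using neq eq by simp
  next
    case (3 r)
    then have le: "ereal r \<le> g {b, c} + 3 * g {a}" "ereal r \<le> g {b} + 2 * g {a}"
      "ereal r \<le> g {c} + 2 * g {a}" "ereal r \<le> g {a} + g {}" "ereal (r / 2) \<le> g {}"
      by (simp_all add: ereal_le_times_iff)
    \<comment> \<open>The common entry \<open>y\<close> of \<open>b\<close> and \<open>c\<close>
      should be as large as possible: the constraints other than \<open>y \<le> r / 2\<close> and
      the one from \<open>g {a}\<close> only weaken as \<open>y\<close> grows. So \<open>y\<close>
      is the smaller of \<open>r / 2\<close>, which keeps \<open>r - 2 * y\<close> nonnegative, and
      \<open>g {a}\<close>.\<close>
    obtain y where y: "0 \<le> y" "y \<le> r / 2" "ereal y \<le> g {a}" "ereal (r - y) \<le> g {}"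
      "ereal (r - 2 * y) \<le> g {b}" "ereal (r - 2 * y) \<le> g {c}" "ereal (r - 3 * y) \<le> g {b, c}"
    proof (cases "ereal (r / 2) \<le> g {a}")
      case True
      show thesis
        by (rule that[of "r / 2"]) (use True le 3(1) nonneg in
          \<open>simp_all add: ereal_le_nonneg\<close>)
    next
      case False
      then obtain y where y: "g {a} = ereal y" "0 \<le> y" "y \<le> r / 2"
        using nonneg[of "{a}"] by (cases "g {a}") auto
      show thesis
        by (rule that[of y]; insert le y; (simp; fail)?;
            cases "g {}"; cases "g {b}"; cases "g {c}"; cases "g {b, c}"; simp add: numeral_eq_ereal)
    qed
    show ?case
      by (rule triple_witness[where x = "r - 2 * y" and y = y and z = y and h = "r - y"])
         (use y neq zero nonneg in \<open>simp_all add: ereal_le_nonneg\<close>)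
  qed
qed

text \<open>An optimal pair and its optimal complement must rise equally, so \<open>c\<close>
  carries half of the total. The other half is shared by \<open>a\<close> and \<open>b\<close> under
  the same bounds as in the two-element problem.\<close>

lemma set_upper_tolerance_pair_and_complement:
  assumes "is_csp P" and neq: "a \<noteq> b" "a \<noteq> c" "b \<noteq> c"
    and g: "g = gap P {a, b, c}"
    and zero: "g {a, b, c} \<noteq> 0" "g {b, c} \<noteq> 0" "g {a, c} \<noteq> 0" "g {a, b} = 0" "g {c} = 0"
  shows "set_upper_tolerance P {a, b, c} = Min {2 * (g {a} + g {b}), 2 * g {}}"
proof -
  have nonneg: "0 \<le> g T" if "T \<subseteq> {a, b, c}" for T
    using gap_nonneg[OF assms(1) that] by (simp add: g)
  show ?thesis
  proof (rule set_upper_tolerance_eqI[OF assms(1)], unfold g[symmetric], goal_cases)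
    case 1
    then show ?case using nonneg by simp
  next
    case (2 v)
    note le = 2(2)
    have eq: "v c = v a + v b"
      using le[of "{a, b}" "{c}"] le[of "{c}" "{a, b}"] zero neq by auto
    have *: "ereal (v a + v b) \<le> g {}" "ereal (v b) \<le> g {a}" "ereal (v a) \<le> g {b}"
      using le[of "{a, b}" "{}"] le[of "{a, b}" "{a}"] le[of "{a, b}" "{b}"] zero neq eq by simp_all
    have "ereal (v a + v b) \<le> g {a} + g {b}" by (rule ereal_add_le_add[OF *(2,3)]) simp
    then show ?case using neq eq * by (simp add: ereal_le_times_iff add_divide_distrib)
  next
    case (3 r)
    then have le: "ereal (r / 2) \<le> g {a} + g {b}" "ereal (r / 2) \<le> g {}"
      by (simp_all add: ereal_le_times_iff)
    obtain y where y: "0 \<le> y" "y \<le> r / 2" "ereal y \<le> g {a}" "ereal (r / 2 - y) \<le> g {b}"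
    proof (cases "ereal (r / 2) \<le> g {a}")
      case True
      show thesis
        by (rule that[of "r / 2"]) (use True 3(1) nonneg in \<open>simp_all add: zero_ereal_def[symmetric]\<close>)
    next
      case False
      then obtain y where y: "g {a} = ereal y" "0 \<le> y" "y \<le> r / 2"
        using nonneg[of "{a}"] by (cases "g {a}") auto
      show thesis
        by (rule that[of y]; insert le y; (simp; fail)?; cases "g {b}"; simp)
    qed
    show ?case
      by (rule triple_witness[where x = "r / 2 - y" and y = y and z = "r / 2" and h = "r / 2"])
         (use y le(2) neq zero nonneg 3(1) in \<open>simp_all add: ereal_le_nonneg\<close>)
  qed
qed

text \<open>Optimal singletons force three equal entries, each bounded by \<open>g {}\<close>;
  larger traces rise by at least as much as the optimal ones and impose nothing further.\<close>

lemma set_upper_tolerance_all_singletons: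
  assumes "is_csp P" and neq: "a \<noteq> b" "a \<noteq> c" "b \<noteq> c"
    and g: "g = gap P {a, b, c}"
    and zero: "g {a, b, c} \<noteq> 0" "g {b, c} \<noteq> 0" "g {a, c} \<noteq> 0" "g {a, b} \<noteq> 0"
      "g {a} = 0" "g {b} = 0" "g {c} = 0"
  shows "set_upper_tolerance P {a, b, c} = 3 * g {}"
proof -
  have nonneg: "0 \<le> g T" if "T \<subseteq> {a, b, c}" for T
    using gap_nonneg[OF assms(1) that] by (simp add: g)
  show ?thesis
  proof (rule set_upper_tolerance_eqI[OF assms(1)], unfold g[symmetric], goal_cases)
    case 1
    then show ?case using nonneg by simp
  next
    case (2 v)
    note le = 2(2)
    have eq: "v b = v a" "v c = v a"
      using le[of "{a}" "{b}"] le[of "{b}" "{a}"] le[of "{a}" "{c}"] le[of "{c}" "{a}"] zero neq by auto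
    have "ereal (v a) \<le> g {}" using le[of "{a}" "{}"] zero by simp
    then show ?case using neq eq by (simp add: ereal_le_times_iff)
  next
    case (3 r)
    then have "ereal (r / 3) \<le> g {}" by (simp add: ereal_le_times_iff)
    moreover have "ereal (- (r / 3)) \<le> g T" "ereal (- (2 * r / 3)) \<le> g T" if "T \<subseteq> {a, b, c}" for T
      using 3(1) nonneg[OF that] by (cases "g T"; simp)+
    ultimately show ?case
      by (intro triple_witness[where x = "r/3" and y = "r/3" and z = "r/3" and h = "r/3"])
         (use 3(1) neq zero in simp_all)
  qed
qed

section \<open>The full trace is optimal: case (a)\<close>

lemma ex_sum_in_box:
  fixes r :: real
  assumes "l1 \<le> u1" "l2 \<le> u2" "l3 \<le> u3" "l1 + l2 + l3 \<le> r" "r \<le> u1 + u2 + u3"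
  shows "\<exists>x y z. l1 \<le> x \<and> x \<le> u1 \<and> l2 \<le> y \<and> y \<le> u2 \<and> l3 \<le> z \<and> z \<le> u3 \<and> x + y + z = r"
proof -
  \<comment> \<open>Greedy choice: each coordinate is as large as its upper bound and the lower
    bounds of the later coordinates permit.\<close>
  define x where "x = min u1 (r - l2 - l3)"
  define y where "y = min u2 (r - x - l3)"
  show ?thesis
    by (rule exI[of _ x], rule exI[of _ y], rule exI[of _ "r - x - y"])
       (use assms in \<open>auto simp: x_def y_def min_def\<close>)
qed

text \<open>The tolerance of \<open>a\<close> is the least gap among the traces avoiding
  \<open>a\<close>; eliminating \<open>b\<close> and \<open>c\<close> by \<open>gap_insert\<close>
  lists these four.\<close>

lemma upper_tolerance_in_triple:
  assumes "is_csp P" and neq: "a \<noteq> b" "a \<noteq> c" "b \<noteq> c"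
    and g: "g = gap P {a, b, c}" and zero: "g {a, b, c} = 0"
  shows "upper_tolerance P a = min (min (g {}) (g {c})) (min (g {b}) (g {b, c}))"
proof -
  have ins: "gap P {a} T = min (min (g T) (g (insert c T))) (min (g (insert b T)) (g (insert c (insert b T))))"
    if "T \<subseteq> {a}" for T
    using that subset_insertI2[OF that, of b] neq gap_insert[OF assms(1), of b "{a}" T] gap_insert[OF assms(1), of c "{a, b}" T]
      gap_insert[OF assms(1), of c "{a, b}" "insert b T"]
    by (simp add: g insert_commute)
  have nonneg: "0 \<le> g T" if "T \<subseteq> {a, b, c}" for T
    using gap_nonneg[OF assms(1) that] by (simp add: g)
  have "gap P {a} {a} = 0"
    using ins[of "{a}"] zero nonneg[of "{a}"] nonneg[of "{a, b}"] nonneg[of "{a, c}"]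
    by (simp add: insert_commute min_def)
  then show ?thesis
    using ins[of "{}"] set_upper_tolerance_single[OF assms(1), of a]
    by (simp add: upper_tolerance_eq_set_upper_tolerance insert_commute)
qed

text \<open>The pair formula, with each gap over \<open>{b, c}\<close> replaced by the smaller of
  its two extensions without and with \<open>a\<close>.\<close>

lemma set_upper_tolerance_pair_in_triple:
  assumes "is_csp P" and neq: "a \<noteq> b" "a \<noteq> c" "b \<noteq> c"
    and g: "g = gap P {a, b, c}" and zero: "g {a, b, c} = 0"
  shows "set_upper_tolerance P {b, c} =
    min (min (g {}) (g {a})) (min (g {b}) (g {a, b}) + min (g {c}) (g {a, c}))"
proof -
  have ins: "gap P {b, c} T = min (g T) (g (insert a T))" if "T \<subseteq> {b, c}" for T
    using that neq gap_insert[OF assms(1), of a "{b, c}" T] by (simp add: g)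
  have nonneg: "0 \<le> g T" if "T \<subseteq> {a, b, c}" for T
    using gap_nonneg[OF assms(1) that] by (simp add: g)
  have "gap P {b, c} {b, c} = 0"
    using ins[of "{b, c}"] zero nonneg[of "{b, c}"] by (simp add: min_def)
  then show ?thesis
    using ins set_upper_tolerance_pair[OF assms(1) neq(3)] by simp
qed


lemma set_upper_tolerance_triple_in_optimal:
  assumes "is_csp P" and neq: "a \<noteq> b" "a \<noteq> c" "b \<noteq> c"
    and g: "g = gap P {a, b, c}" and zero: "g {a, b, c} = 0"
  shows "set_upper_tolerance P {a, b, c} =
    Min {g {}, upper_tolerance P a + set_upper_tolerance P {b, c},
      upper_tolerance P b + set_upper_tolerance P {a, c},
      upper_tolerance P c + set_upper_tolerance P {a, b},
      ereal (1/2) * (set_upper_tolerance P {a, b} + set_upper_tolerance P {a, c} + set_upper_tolerance P {b, c})}"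
proof -
  have nonneg: "0 \<le> g T" if "T \<subseteq> {a, b, c}" for T
    using gap_nonneg[OF assms(1) that] by (simp add: g)
  define ua where "ua = min (min (g {}) (g {c})) (min (g {b}) (g {b, c}))"
  define ub where "ub = min (min (g {}) (g {c})) (min (g {a}) (g {a, c}))"
  define uc where "uc = min (min (g {}) (g {b})) (min (g {a}) (g {a, b}))"
  define uab where "uab = min (min (g {}) (g {c})) (min (g {a}) (g {a, c}) + min (g {b}) (g {b, c}))"
  define uac where "uac = min (min (g {}) (g {b})) (min (g {a}) (g {a, b}) + min (g {c}) (g {b, c}))"
  define ubc where "ubc = min (min (g {}) (g {a})) (min (g {b}) (g {a, b}) + min (g {c}) (g {a, c}))"
  have zero': "g {b, a, c} = 0" "g {c, a, b} = 0" and g': "g = gap P {b, a, c}" "g = gap P {c, a, b}"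
    using zero g by (simp_all add: insert_commute)
  note neq' = neq(1)[symmetric] neq(2,3)[symmetric]
  have tol: "upper_tolerance P a = ua" "upper_tolerance P b = ub" "upper_tolerance P c = uc"
    unfolding ua_def ub_def uc_def
    using upper_tolerance_in_triple[OF assms(1) neq g zero]
      upper_tolerance_in_triple[OF assms(1) neq'(1) neq(3,2) g'(1) zero'(1)]
      upper_tolerance_in_triple[OF assms(1) neq'(2,3) neq(1) g'(2) zero'(2)]
    by (simp_all only: insert_commute min.commute min.left_commute)
  have tol2: "set_upper_tolerance P {a, b} = uab" "set_upper_tolerance P {a, c} = uac"
    "set_upper_tolerance P {b, c} = ubc"
    unfolding uab_def uac_def ubc_def
    using set_upper_tolerance_pair_in_triple[OF assms(1) neq g zero]
      set_upper_tolerance_pair_in_triple[OF assms(1) neq'(1) neq(3,2) g'(1) zero'(1)]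
      set_upper_tolerance_pair_in_triple[OF assms(1) neq'(2,3) neq(1) g'(2) zero'(2)]
    by (simp_all only: insert_commute)
  have u_nonneg: "0 \<le> ua" "0 \<le> ub" "0 \<le> uc" "0 \<le> uab" "0 \<le> uac" "0 \<le> ubc"
    using nonneg by (simp_all add: ua_def ub_def uc_def uab_def uac_def ubc_def)
  have u_le: "ua \<le> g {b}" "ua \<le> g {c}" "ua \<le> g {b, c}" "ub \<le> g {c}" "ub \<le> g {a, c}" "uc \<le> g {a, b}"
    "ubc \<le> g {a}" "uac \<le> g {b}" "uab \<le> g {c}"
    by (simp_all add: ua_def ub_def uc_def uab_def uac_def ubc_def min.coboundedI1 min.coboundedI2)
  have ubc_le: "ubc \<le> g {a, b} + g {a, c}"
    unfolding ubc_def by (intro min.coboundedI2 add_mono) simp_all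
  show ?thesis
    unfolding tol tol2
  proof (rule set_upper_tolerance_eqI[OF assms(1)], unfold g[symmetric], goal_cases)
    case 1
    then show ?case using nonneg u_nonneg by simp
  next
    case (2 v)
    have v: "0 \<le> v a" "0 \<le> v b" "0 \<le> v c" using 2(1) by auto
    \<comment> \<open>Comparing the optimal full trace with \<open>U\<close> bounds the increase on
      the complement of \<open>U\<close>.\<close>
    have le: "ereal (v a + v b + v c - sum v U) \<le> g U" if "U \<subseteq> {a, b, c}" for U
      using 2(2)[OF subset_refl that] zero neq by (simp add: add.assoc)
    have tot: "ereal (v a + v b + v c) \<le> g {}" and two: "ereal (v b + v c) \<le> g {a}"
      "ereal (v a + v c) \<le> g {b}" "ereal (v a + v b) \<le> g {c}"
      and one: "ereal (v c) \<le> g {a, b}" "ereal (v b) \<le> g {a, c}" "ereal (v a) \<le> g {b, c}"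
      using le[of "{}"] le[of "{a}"] le[of "{b}"] le[of "{c}"] le[of "{a, b}"] le[of "{a, c}"]
        le[of "{b, c}"] neq by simp_all
    \<comment> \<open>Entries are nonnegative, so a bound on a larger sum containing an entry bounds
      that entry as well.\<close>
    have single: "ereal (v a) \<le> ua" "ereal (v b) \<le> ub" "ereal (v c) \<le> uc"
      unfolding ua_def ub_def uc_def min.bounded_iff
      using one v by (auto intro: ereal_le_trans[OF tot] ereal_le_trans[OF two(1)]
          ereal_le_trans[OF two(2)] ereal_le_trans[OF two(3)])
    have "ereal (v b) \<le> min (g {a}) (g {a, c})" "ereal (v a) \<le> min (g {b}) (g {b, c})"
      "ereal (v c) \<le> min (g {a}) (g {a, b})" "ereal (v a) \<le> min (g {c}) (g {b, c})"
      "ereal (v c) \<le> min (g {b}) (g {a, b})" "ereal (v b) \<le> min (g {c}) (g {a, c})"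
      unfolding min.bounded_iff
      using one v by (auto intro: ereal_le_trans[OF two(1)] ereal_le_trans[OF two(2)] ereal_le_trans[OF two(3)])
    then have pair: "ereal (v a + v b) \<le> uab" "ereal (v a + v c) \<le> uac" "ereal (v b + v c) \<le> ubc"
      unfolding uab_def uac_def ubc_def min.bounded_iff
      using two v by (auto intro: ereal_le_trans[OF tot] ereal_add_le_add)
    have "ereal (v a + v b + v c) \<le> ua + ubc" "ereal (v a + v b + v c) \<le> ub + uac"
      "ereal (v a + v b + v c) \<le> uc + uab"
      using ereal_add_le_add[OF single(1) pair(3) refl] ereal_add_le_add[OF single(2) pair(2) refl]
        ereal_add_le_add[OF single(3) pair(1) refl] by (simp_all add: algebra_simps)
    \<comment> \<open>Every entry lies in exactly two of the three pairs.\<close>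
    moreover have "ereal (2 * (v a + v b + v c)) \<le> uab + uac + ubc"
      by (rule ereal_add_le_add[OF ereal_add_le_add[OF pair(1,2) refl] pair(3)]) simp
    then have "ereal (v a + v b + v c) \<le> ereal (1/2) * (uab + uac + ubc)"
      by (subst ereal_le_times_iff) (simp_all add: mult.commute)
    ultimately show ?case using tot neq by (simp add: add.assoc)
  next
    case (3 r)
    then have r: "ereal r \<le> g {}" "ereal r \<le> ua + ubc" "ereal r \<le> ub + uac" "ereal r \<le> uc + uab"
      and half: "ereal r \<le> ereal (1/2) * (uab + uac + ubc)"
      unfolding atomize_conj by (simp only: Min_ge_iff finite.intros insert_not_empty ball_simps simp_thms)
    have "ereal (2 * r) \<le> uab + uac + ubc"
      using half by (subst (asm) ereal_le_times_iff) (simp_all add: mult.commute)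
    also have "\<dots> \<le> g {a} + g {b} + g {c}"
      using add_mono[OF add_mono[OF u_le(9,8)] u_le(7)] by (simp add: ac_simps)
    finally have all3: "ereal (2 * r) \<le> g {a} + g {b} + g {c}" .
    \<comment> \<open>Truncating gaps at \<open>r\<close> makes them real; no constraint is lost,
      since sums of entries never exceed the total \<open>r\<close>.\<close>
    define n where "n T = real_of_ereal (min (g T) (ereal r))" for T
    have n: "ereal (n T) = min (g T) (ereal r)" "0 \<le> n T" "ereal (n T) \<le> g T" "n T \<le> r" if "T \<subseteq> {a, b, c}" for T
      using 3(1) nonneg[OF that] by (cases "g T"; simp add: n_def min_def)+
    have n_add: "r \<le> n T + n U" if "ereal r \<le> g T + g U" "T \<subseteq> {a, b, c}" "U \<subseteq> {a, b, c}" for T U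
      using that(1) n[OF that(2)] n[OF that(3)]
      by (cases "g T"; cases "g U"; simp add: min_def split: if_splits)
    \<comment> \<open>At total \<open>r\<close>, the bound on \<open>y + z\<close> by
      \<open>n {a}\<close> reads \<open>r - n {a} \<le> x\<close>, and \<open>x\<close> is bounded
      above by \<open>n {b, c}\<close>. These inequalities say that each side of the box is a
      nonempty interval.\<close>
    have opp: "r \<le> n {a} + n {b, c}" "r \<le> n {b} + n {a, c}" "r \<le> n {c} + n {a, b}"
      by (rule n_add; (simp; fail)?; rule order_trans[OF r(2)] order_trans[OF r(3)] order_trans[OF r(4)],
          subst add.commute, rule add_mono; fact u_le)+
    \<comment> \<open>If one singleton gap is truncated to \<open>r\<close>, the other two must
      still supply \<open>r\<close>; this makes the bound \<open>all3\<close> survive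
      truncation.\<close>
    have cross: "r \<le> n {a} + n {b}" "r \<le> n {a} + n {c}" "r \<le> n {b} + n {c}"
      by (rule n_add; (simp; fail)?; rule order_trans[OF r(2)] order_trans[OF r(3)],
          subst add.commute, rule add_mono; fact u_le)+
    have "ereal r \<le> g {b, c} + (g {a, b} + g {a, c})"
      using r(2) add_mono[OF u_le(3) ubc_le] by (rule order_trans)
    \<comment> \<open>The sum of the upper bounds of the box reaches \<open>r\<close>.\<close>
    then have singles: "r \<le> n {a, b} + n {a, c} + n {b, c}"
      using n(1,2)[of "{a, b}"] n(1,2)[of "{a, c}"] n(1,2)[of "{b, c}"]
      by (cases "g {a, b}"; cases "g {a, c}"; cases "g {b, c}"; simp add: min_def split: if_splits)
    \<comment> \<open>Equivalently, the sum of the lower bounds of the box is at most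
      \<open>r\<close>.\<close>
    have all3': "2 * r \<le> n {a} + n {b} + n {c}"
      using cross all3 n(1)[of "{a}"] n(1)[of "{b}"] n(1)[of "{c}"]
      by (cases "g {a}"; cases "g {b}"; cases "g {c}"; simp add: min_def split: if_splits)
    obtain x y z where "r - n {a} \<le> x" "x \<le> n {b, c}" "r - n {b} \<le> y" "y \<le> n {a, c}"
      "r - n {c} \<le> z" "z \<le> n {a, b}" "x + y + z = r"
      using ex_sum_in_box[of "r - n {a}" "n {b, c}" "r - n {b}" "n {a, c}" "r - n {c}" "n {a, b}" r]
        opp singles all3' by auto
    note xyz = this
    have "ereal (r - x) \<le> g {a}" "ereal (r - y) \<le> g {b}" "ereal (r - z) \<le> g {c}"
      "ereal (r - (x + y)) \<le> g {a, b}" "ereal (r - (x + z)) \<le> g {a, c}" "ereal (r - (y + z)) \<le> g {b, c}"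
      by (rule ereal_le_trans[OF n(3)]; use xyz in simp)+
    \<comment> \<open>The lower bounds \<open>r - n {a}\<close> and its analogues are nonnegative
      because of the truncation.\<close>
    moreover have "0 \<le> x" "0 \<le> y" "0 \<le> z"
      using xyz n(4)[of "{a}"] n(4)[of "{b}"] n(4)[of "{c}"] by auto
    ultimately show ?case
      by (intro triple_witness[where x = x and y = y and z = z and h = r])
        (use neq r(1) zero xyz in \<open>(assumption | simp)+\<close>)
  qed
qed


section \<open>Translation of the hypotheses into gaps and the final case distinction\<close>

lemma min_cost_D_sim_minus_opt:
  "A \<inter> B = {} \<Longrightarrow> min_cost P (D_sim P A B) - opt_value P = gap P (A \<union> B) B"
proof -
  assume "A \<inter> B = {}"
  then have "A \<union> B - B = A" by blast
  then show ?thesis by (simp add: gap_def)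
qed

lemma triple_eq_cases:
  assumes "{x, y, z} = {a, b, c}" "a \<noteq> b" "a \<noteq> c" "b \<noteq> c"
  shows "x = a \<and> y = b \<and> z = c \<or> x = a \<and> y = c \<and> z = b \<or> x = b \<and> y = a \<and> z = c \<or>
    x = b \<and> y = c \<and> z = a \<or> x = c \<and> y = a \<and> z = b \<or> x = c \<and> y = b \<and> z = a"
proof -
  have "x \<in> {a, b, c}" "y \<in> {a, b, c}" "z \<in> {a, b, c}"
    "a \<in> {x, y, z}" "b \<in> {x, y, z}" "c \<in> {x, y, z}"
    using assms(1) by blast+
  then show ?thesis using assms(2-) by auto
qed

theorem theorem9:
  fixes P :: "'a csp" and e1 e2 e3 :: 'a
  assumes "is_csp P"
    and "{e1, e2, e3} \<subseteq> ground P"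
    and "e1 \<noteq> e2" and "e1 \<noteq> e3" and "e2 \<noteq> e3"
  shows "let
      E = {e1, e2, e3};
      f = min_cost P;
      copt = opt_value P;
      u = set_upper_tolerance P;
      hypA = (f (D_plus P E) = copt);
      hypB = (f (D_sim P {e1} {e2, e3}) = copt \<and>
              f (D_sim P {e2} {e1, e3}) = copt \<and>
              f (D_sim P {e3} {e1, e2}) = copt);
      hypC = (\<lambda>i1 i2 i3. {i1, i2, i3} = E \<and>
              f (D_sim P {i3} {i1, i2}) = copt \<and>
              f (D_sim P {i2} {i1, i3}) = copt);
      hypD = (\<lambda>i1 i2 i3. {i1, i2, i3} = E \<and>
              f (D_sim P {i3} {i1, i2}) = copt \<and>
              f (D_sim P {i1, i2} {i3}) = copt);
      someC = (\<exists>i1 i2 i3. hypC i1 i2 i3);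
      someD = (\<exists>i1 i2 i3. hypD i1 i2 i3);
      hypE = (f (D_sim P {e1, e2} {e3}) = copt \<and>
              f (D_sim P {e1, e3} {e2}) = copt \<and>
              f (D_sim P {e2, e3} {e1}) = copt)
    in
      (hypA \<longrightarrow>
        u E = Min {f (D_minus P E) - copt,
                   upper_tolerance P e1 + u {e2, e3},
                   upper_tolerance P e2 + u {e1, e3},
                   upper_tolerance P e3 + u {e1, e2},
                   ereal (1/2) * (u {e1, e2} + u {e1, e3} + u {e2, e3})}) \<and>
      (\<not> hypA \<and> hypB \<longrightarrow>
        u E = Min {3 * (f (D_sim P {e2, e3} {e1}) - copt),
                   3 * (f (D_sim P {e1, e3} {e2}) - copt),
                   3 * (f (D_sim P {e1, e2} {e3}) - copt),
                   ereal (3/2) * (f (D_minus P E) - copt)}) \<and>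
      (\<forall>i1 i2 i3. \<not> hypA \<and> \<not> hypB \<and> hypC i1 i2 i3 \<longrightarrow>
        u E = Min {(f (D_sim P {i1} {i2, i3}) - copt) + 3 * (f (D_sim P {i2, i3} {i1}) - copt),
                   (f (D_sim P {i1, i3} {i2}) - copt) + 2 * (f (D_sim P {i2, i3} {i1}) - copt),
                   (f (D_sim P {i1, i2} {i3}) - copt) + 2 * (f (D_sim P {i2, i3} {i1}) - copt),
                   (f (D_sim P {i2, i3} {i1}) - copt) + (f (D_minus P E) - copt),
                   2 * (f (D_minus P E) - copt)}) \<and>
      (\<forall>i1 i2 i3. \<not> hypA \<and> \<not> hypB \<and> \<not> someC \<and> hypD i1 i2 i3 \<longrightarrow>
        u E = Min {2 * ((f (D_sim P {i2, i3} {i1}) - copt) + (f (D_sim P {i1, i3} {i2}) - copt)),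
                   2 * (f (D_minus P E) - copt)}) \<and>
      (\<not> hypA \<and> \<not> hypB \<and> \<not> someC \<and> \<not> someD \<and> hypE \<longrightarrow>
        u E = 3 * (f (D_minus P E) - copt)) \<and>
      (\<not> hypA \<and> \<not> hypB \<and> \<not> someC \<and> \<not> someD \<and> \<not> hypE \<longrightarrow>
        u E = \<infinity>)"
proof -
  define E where "E = {e1, e2, e3}"
  define g where "g = gap P E"
  note neq = assms(3-5)
  have csp: "is_csp P" by fact
  have D_plus: "D_plus P E = D_sim P {} E" and D_minus: "D_minus P E = D_sim P E {}"
    by (simp_all add: D_plus_def D_minus_def D_sim_def)
  have gap: "min_cost P (D_sim P A B) - opt_value P = g B" if "A \<union> B = E" "A \<inter> B = {}" for A B
    using min_cost_D_sim_minus_opt[OF that(2), of P] that(1) by (simp add: g_def)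
  have gap_minus: "min_cost P (D_minus P E) - opt_value P = g {}"
    unfolding D_minus by (rule gap) auto
  note lets = Let_def E_def[symmetric] gap_minus
  show ?thesis
  proof (cases "feasible P = {}")
    case True
    have infinite: "set_upper_tolerance P F = \<infinity>" if "finite F" "F \<noteq> {}" for F
      using that set_upper_tolerance_eq_infinity[OF csp] gap_empty_feasible[OF True] by fastforce
    \<comment> \<open>Without feasible solutions the hypothesis of (a) holds as
      \<open>\<infinity> = \<infinity>\<close>, so only (a) is left, and there both sides are
      infinite.\<close>
    have "min_cost P (D_plus P E) = opt_value P" "g {} = \<infinity>"
      using gap_empty_feasible[OF True]
      by (simp_all add: g_def D_plus_def opt_value_def True)
    then show ?thesis
      unfolding lets
      by (simp add: upper_tolerance_eq_set_upper_tolerance infinite E_def)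
  next
    case False
    have zero: "min_cost P (D_sim P A B) = opt_value P \<longleftrightarrow> g B = 0"
      if "A \<union> B = E" "A \<inter> B = {}" for A B
      unfolding min_cost_eq_opt_value_iff[OF csp False] gap[OF that] ..
    have zero_plus: "min_cost P (D_plus P E) = opt_value P \<longleftrightarrow> g E = 0"
      unfolding D_plus by (rule zero) auto
    have distinct: "x \<noteq> y" "x \<noteq> z" "y \<noteq> z" if "{x, y, z} = E" for x y z
      using triple_eq_cases[OF that[unfolded E_def] neq] neq by auto
    have triple: "min_cost P (D_sim P {x} {y, z}) - opt_value P = g {y, z}"
      "min_cost P (D_sim P {y, z} {x}) - opt_value P = g {x}"
      "min_cost P (D_sim P {x} {y, z}) = opt_value P \<longleftrightarrow> g {y, z} = 0"
      "min_cost P (D_sim P {y, z} {x}) = opt_value P \<longleftrightarrow> g {x} = 0"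
      if "{x, y, z} = E" for x y z
      using distinct[OF that] that
        gap[of "{x}" "{y, z}"] gap[of "{y, z}" "{x}"] zero[of "{x}" "{y, z}"] zero[of "{y, z}" "{x}"]
      by (auto simp: insert_commute)
    have perm: "{x, y, z} = E \<Longrightarrow> {y, x, z} = E" "{x, y, z} = E \<Longrightarrow> {z, x, y} = E" for x y z
      by (auto simp: insert_commute)
    have E: "{e1, e2, e3} = E" "{e2, e1, e3} = E" "{e3, e1, e2} = E"
      by (auto simp: E_def)
    have hypC: "{x, y, z} = E \<and> min_cost P (D_sim P {z} {x, y}) = opt_value P \<and>
        min_cost P (D_sim P {y} {x, z}) = opt_value P \<longleftrightarrow>
        {x, y, z} = E \<and> g {x, y} = 0 \<and> g {x, z} = 0" for x y z
      by (intro conj_cong refl triple(3)[OF perm(2)] triple(3)[OF perm(1)])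
    have hypD: "{x, y, z} = E \<and> min_cost P (D_sim P {z} {x, y}) = opt_value P \<and>
        min_cost P (D_sim P {x, y} {z}) = opt_value P \<longleftrightarrow>
        {x, y, z} = E \<and> g {x, y} = 0 \<and> g {z} = 0" for x y z
      by (intro conj_cong refl triple(3)[OF perm(2)] triple(4)[OF perm(2)])
    have g_E: "g = gap P {x, y, z}" if "{x, y, z} = E" for x y z
      using that by (simp add: g_def)
    have hypB: "g {y, z} = 0 \<and> g {x, z} = 0 \<and> g {x, y} = 0 \<longleftrightarrow>
        g {e2, e3} = 0 \<and> g {e1, e3} = 0 \<and> g {e1, e2} = 0" if "{x, y, z} = E" for x y z
      using triple_eq_cases[OF that[unfolded E_def] neq] by (auto simp: insert_commute)
    show ?thesis
      unfolding lets zero_plus hypC hypD triple[OF E(1)] triple[OF E(2)] triple[OF E(3)]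
    proof (intro conjI impI allI, goal_cases)
      case 1
      then show ?case
        using set_upper_tolerance_triple_in_optimal[OF csp neq g_E[OF E(1)]] by (simp add: E_def)
    next
      case 2
      then show ?case
        using set_upper_tolerance_all_pairs[OF csp neq g_E[OF E(1)]] by (simp add: E_def)
    next
      case (3 x y z)
      then have I: "{x, y, z} = E" and "g {x, y} = 0" "g {x, z} = 0" "g E \<noteq> 0" by auto
      \<comment> \<open>A third optimal pair would give the hypothesis of (b), which is symmetric in
        the labels.\<close>
      moreover from this have "g {y, z} \<noteq> 0" using 3 hypB[OF I] by auto
      ultimately have "set_upper_tolerance P {x, y, z} = Min {g {y, z} + 3 * g {x}, g {y} + 2 * g {x},
          g {z} + 2 * g {x}, g {x} + g {}, 2 * g {}}"
        by (intro set_upper_tolerance_two_pairs[OF csp distinct[OF I] g_E[OF I]]) simp_all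
      then show ?case
        unfolding I triple(1,2)[OF I] triple(2)[OF perm(1)[OF I]] triple(2)[OF perm(2)[OF I]] .
    next
      case (4 x y z)
      then have I: "{x, y, z} = E" and "g {x, y} = 0" "g {z} = 0" "g E \<noteq> 0" by auto
      moreover have noC: "\<And>x y z. {x, y, z} = E \<Longrightarrow> g {x, y} \<noteq> 0 \<or> g {x, z} \<noteq> 0"
        using 4 by blast
      \<comment> \<open>A second optimal pair would share an element with \<open>{x, y}\<close> and
        give the hypothesis of (c).\<close>
      have "g {x, z} \<noteq> 0" "g {y, z} \<noteq> 0"
        using noC[OF I] noC[OF perm(1)[OF I]] \<open>g {x, y} = 0\<close> by (auto simp: insert_commute)
      ultimately have "set_upper_tolerance P {x, y, z} = Min {2 * (g {x} + g {y}), 2 * g {}}"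
        by (intro set_upper_tolerance_pair_and_complement[OF csp distinct[OF I] g_E[OF I]]) simp_all
      then show ?case
        unfolding I triple(2)[OF I] triple(2)[OF perm(1)[OF I]] .
    next
      case 5
      then have noD: "\<And>x y z. {x, y, z} = E \<Longrightarrow> g {x, y} \<noteq> 0 \<or> g {z} \<noteq> 0" by blast
      \<comment> \<open>All singletons are optimal here, so any optimal pair would give the
        hypothesis of (d).\<close>
      have "g {e1, e2} \<noteq> 0" "g {e1, e3} \<noteq> 0" "g {e2, e3} \<noteq> 0"
        using 5 noD[of e1 e2 e3] noD[of e1 e3 e2] noD[of e2 e3 e1] by (auto simp: E_def insert_commute)
      then show ?case
        using 5 set_upper_tolerance_all_singletons[OF csp neq g_E[OF E(1)]] by (simp add: E_def)
    next
      case 6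
      then have noC: "\<And>x y z. {x, y, z} = E \<Longrightarrow> g {x, y} \<noteq> 0 \<or> g {x, z} \<noteq> 0"
        and noD: "\<And>x y z. {x, y, z} = E \<Longrightarrow> g {x, y} \<noteq> 0 \<or> g {z} \<noteq> 0" by blast+
      have noCs: "g {e1, e2} \<noteq> 0 \<or> g {e1, e3} \<noteq> 0" "g {e1, e2} \<noteq> 0 \<or> g {e2, e3} \<noteq> 0"
        "g {e1, e3} \<noteq> 0 \<or> g {e2, e3} \<noteq> 0"
        using noC[of e1 e2 e3] noC[of e2 e1 e3] noC[of e3 e1 e2] by (auto simp: E_def insert_commute)
      have noDs: "g {e1, e2} \<noteq> 0 \<or> g {e3} \<noteq> 0" "g {e1, e3} \<noteq> 0 \<or> g {e2} \<noteq> 0"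
        "g {e2, e3} \<noteq> 0 \<or> g {e1} \<noteq> 0"
        using noD[of e1 e2 e3] noD[of e1 e3 e2] noD[of e2 e3 e1] by (auto simp: E_def insert_commute)
      have "g E \<noteq> 0" "g {e1} \<noteq> 0 \<or> g {e2} \<noteq> 0 \<or> g {e3} \<noteq> 0" using 6 by auto
      \<comment> \<open>At most one pair is optimal. If one is, its complement is not an optimal
        singleton, so the third element lies in no optimal trace; if none is, take an element whose
        singleton is not optimal.\<close>
      then have "\<exists>e\<in>E. \<forall>T\<subseteq>{e1, e2, e3}. g T = 0 \<longrightarrow> e \<notin> T"
        unfolding all_subset_triple using noCs noDs neq by (auto simp: E_def)
      then show ?case
        using set_upper_tolerance_eq_infinity[OF csp, of E] by (auto simp: E_def g_def)
    qed
  qed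
qed

end
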